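(* Let $n>p$ be positive integers, let $M\in\mathbb{R}^{n\times p}$ be arbitrary, let $X\in\mathrm{St}(n,p)$, and set $N=\operatorname{skew}(MX^\top)\in\mathbb{R}^{n\times n}$. Let $r=\operatorname{rank}N$ and let $N=U\Sigma V^\top$ be a singular value decomposition of $N$ (with $U,V\in O(n)$), written in block form as $$N=\begin{bmatrix}U_1&U_2\end{bmatrix}\begin{bmatrix}\Sigma_r&\mathbf{0}\\ \mathbf{0}&\mathbf{0}\end{bmatrix}\begin{bmatrix}V_1^\top\\ V_2^\top\end{bmatrix},$$ where $U_1,V_1\in\mathbb{R}^{n\times r}$, $U_2,V_2\in\mathbb{R}^{n\times(n-r)}$, and $\Sigma_r$ is the $r\times r$ diagonal matrix of the nonzero singular values of $N$. Consider the problem $$\min_{Y\in\mathbb{R}^{n\times n}}\ \langle \operatorname{skew}(MX^\top),Y\rangle\quad\text{subject to}\quad \|Y\|_2\le 1.$$ Then the optimal objective value of this problem is $-\|N\|_*$, and the general optimal solution (i.e. the set of all optimal solutions) is given by $$Y_{\mathrm{opt}}=-U\begin{bmatrix}I_r&\mathbf{0}\\ \mathbf{0}&W\end{bmatrix}V^\top=-U_1V_1^\top-U_2WV_2^\top,$$ where $W\in\mathbb{R}^{(n-r)\times(n-r)}$ satisfies $\|W\|_2\le 1$. In particular, if $N$ is nonsingular, then the optimal solution is $Y_{\mathrm{opt}}=-\operatorname{msign}(N)=-UV^\top$.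
   Context: $\mathrm{St}(n,p)=\{X\in\mathbb{R}^{n\times p}: X^\top X=I_p\}$ with $n>p$ is the Stiefel manifold, and $O(n)$ is the set of orthogonal $n\times n$ matrices. $\langle A,B\rangle=\operatorname{tr}(A^\top B)$ is the Frobenius inner product. For a square matrix $A$, $\operatorname{skew}(A)=\frac12(A-A^\top)$. $\|A\|_2$ is the spectral norm (largest singular value) and $\|A\|_*$ is the nuclear norm (sum of singular values). For $A\in\mathbb{R}^{m\times n}$ with $m\ge n$ and full column rank, $\operatorname{msign}(A)=A(A^\top A)^{-1/2}=UV^\top$, where $A=U\Sigma V^\top$ is a thin singular value decomposition. *)

theory Defs
  imports
    "HOL-Computational_Algebra.Polynomial_Factorial"
    "Jordan_Normal_Form.Char_Poly"
    "Jordan_Normal_Form.Gauss_Jordan_Elimination"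
    "Jordan_Normal_Form.DL_Rank"
begin

definition orthogonal_matrices :: "nat \<Rightarrow> real mat set" where
  "orthogonal_matrices n =
     {Q \<in> carrier_mat n n. transpose_mat Q * Q = 1\<^sub>m n \<and> Q * transpose_mat Q = 1\<^sub>m n}"

definition stiefel :: "nat \<Rightarrow> nat \<Rightarrow> real mat set" where
  "stiefel n p = {X \<in> carrier_mat n p. transpose_mat X * X = 1\<^sub>m p}"

definition skew :: "real mat \<Rightarrow> real mat" where
  "skew A = (1/2) \<cdot>\<^sub>m (A - transpose_mat A)"

definition mat_trace :: "real mat \<Rightarrow> real" where
  "mat_trace A = (\<Sum>i<dim_row A. A $$ (i,i))"

definition frob_inner :: "real mat \<Rightarrow> real mat \<Rightarrow> real" where
  "frob_inner A B = mat_trace (transpose_mat A * B)"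

text \<open>
  The singular values of \<open>A\<close>, counted with multiplicity, are the square roots of the eigenvalues
  of \<open>A\<^sup>T A\<close>; all of these eigenvalues are real and nonnegative.  If \<open>A\<close> has more columns than
  rows, the multiset contains additional zeros compared to the convention of listing only
  \<open>min (dim_row A) (dim_col A)\<close> values, which affects neither of the two norms.
\<close>

definition singular_values :: "real mat \<Rightarrow> real multiset" where
  "singular_values A = image_mset sqrt (proots (char_poly (transpose_mat A * A)))"

text \<open>
  Singular values are nonnegative, so inserting \<open>0\<close> only has an effect for matrices without
  columns, whose norm is thereby \<open>0\<close>.
\<close>

definition spectral_norm :: "real mat \<Rightarrow> real" where
  "spectral_norm A = Max (insert 0 (set_mset (singular_values A)))"

definition nuclear_norm :: "real mat \<Rightarrow> real" where
  "nuclear_norm A = sum_mset (singular_values A)"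

definition is_svd :: "real mat \<Rightarrow> real mat \<Rightarrow> real mat \<Rightarrow> real mat \<Rightarrow> bool" where
  "is_svd A U S V \<longleftrightarrow>
     U \<in> orthogonal_matrices (dim_row A) \<and>
     V \<in> orthogonal_matrices (dim_col A) \<and>
     S \<in> carrier_mat (dim_row A) (dim_col A) \<and>
     diagonal_mat S \<and>
     (\<forall>i < min (dim_row A) (dim_col A). 0 \<le> S $$ (i,i)) \<and>
     A = U * S * transpose_mat V"

definition hcat :: "real mat \<Rightarrow> real mat \<Rightarrow> real mat" where
  "hcat A B = four_block_mat A B (0\<^sub>m 0 (dim_col A)) (0\<^sub>m 0 (dim_col B))"

definition psd_mat :: "real mat \<Rightarrow> bool" where
  "psd_mat A \<longleftrightarrow> square_mat A \<and> transpose_mat A = A \<and>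
     (\<forall>v \<in> carrier_vec (dim_row A). 0 \<le> v \<bullet> (A *\<^sub>v v))"

text \<open>The principal square root, which exists and is unique for positive semidefinite \<open>A\<close>.\<close>

definition psd_sqrt :: "real mat \<Rightarrow> real mat" where
  "psd_sqrt A = (THE B. B \<in> carrier_mat (dim_row A) (dim_row A) \<and> psd_mat B \<and> B * B = A)"

text \<open>
  \<open>A (A\<^sup>T A)\<^sup>-\<^sup>1\<^sup>/\<^sup>2\<close>, meaningful only for \<open>A\<close> of full column rank: otherwise \<open>mat_inverse\<close> yields
  \<open>None\<close>.
\<close>

definition msign :: "real mat \<Rightarrow> real mat" where
  "msign A = A * the (mat_inverse (psd_sqrt (transpose_mat A * A)))"

definition is_min_value :: "('a \<Rightarrow> real) \<Rightarrow> ('a \<Rightarrow> bool) \<Rightarrow> real \<Rightarrow> bool" where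
  "is_min_value f P m \<longleftrightarrow> (\<exists>x. P x \<and> f x = m) \<and> (\<forall>x. P x \<longrightarrow> m \<le> f x)"

end

theory Submission
  imports
    Defs
    "Jordan_Normal_Form.Spectral_Radius"
    "HOL-Real_Asymp.Real_Asymp"
begin

text \<open>
  A matrix has spectral norm at most 1 iff it is a contraction for the Euclidean norm. With
  \<open>Z = U\<^sup>T Y V\<close>, which is a contraction iff \<open>Y\<close> is, the objective becomes
  \<open>\<Sum>i. \<sigma>\<^sub>i Z\<^sub>i\<^sub>i\<close>. As the entries of \<open>Z\<close> are at most 1 in absolute value, this is at least the negated
  nuclear norm, with equality iff \<open>Z\<^sub>i\<^sub>i = -1\<close> whenever \<open>\<sigma>\<^sub>i > 0\<close>. The rows and columns of a
  contraction have Euclidean norm at most 1, so an entry \<open>-1\<close> annihilates the rest of its row and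
  column, and only a contraction \<open>W\<close> in the lower right block remains free.
\<close>

text \<open>Both norms are defined through the roots of the characteristic polynomial of a Gram
  matrix, which reveals little about products, transposes or single entries. Only one half of the
  translation into contractions is deep: a bound on all eigenvalues of a symmetric matrix has to
  bound its quadratic form on every vector. Instead of diagonalising, the proof compares growth
  rates of matrix powers. The nuclear norm needs no such argument, since it is evaluated only at
  \<open>N\<close>, where the given decomposition diagonalises the Gram matrix. The nonsingular case
  has its own obstacle: \<open>msign\<close> contains a square root given by a definite description,
  so the root obtained from the decomposition must also be shown to be the only one.\<close>

section \<open>Real inner products, Gram matrices and powers of symmetric matrices\<close>

lemma scalar_prod_self_ge_0: "0 \<le> v \<bullet> (v :: real vec)"
  by (simp add: scalar_prod_def sum_nonneg)

lemma scalar_prod_self_eq_0_iff: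
  fixes v :: "real vec"
  assumes "v \<in> carrier_vec n"
  shows "v \<bullet> v = 0 \<longleftrightarrow> v = 0\<^sub>v n"
proof
  assume "v \<bullet> v = 0"
  then have "\<forall>i \<in> {0..<n}. v $ i * v $ i = 0"
    using assms unfolding scalar_prod_def by (subst (asm) sum_nonneg_eq_0_iff) auto
  then show "v = 0\<^sub>v n"
    using assms by (intro eq_vecI) auto
qed (use assms in auto)

lemma scalar_prod_Cauchy_Schwarz:
  fixes u w :: "real vec"
  assumes "u \<in> carrier_vec n" "w \<in> carrier_vec n"
  shows "(u \<bullet> w)\<^sup>2 \<le> (u \<bullet> u) * (w \<bullet> w)"
proof (cases "w \<bullet> w = 0")
  case True
  then show ?thesis using assms scalar_prod_self_eq_0_iff[OF assms(2)] by simp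
next
  case False
  \<comment> \<open>This is \<open>w \<bullet> w\<close> times the component of \<open>u\<close>
    orthogonal to \<open>w\<close>; the scaling avoids a division.\<close>
  define x where "x = (w \<bullet> w) \<cdot>\<^sub>v u - (u \<bullet> w) \<cdot>\<^sub>v w"
  have "x \<bullet> x = (w \<bullet> w) * ((u \<bullet> u) * (w \<bullet> w) - (u \<bullet> w)\<^sup>2)"
    unfolding x_def using assms comm_scalar_prod[OF assms]
    by (simp add: minus_scalar_prod_distrib[of _ n] scalar_prod_minus_distrib[of _ n]
        algebra_simps power2_eq_square)
  then show ?thesis
    using False scalar_prod_self_ge_0[of x] scalar_prod_self_ge_0[of w]
    by (simp add: zero_le_mult_iff)
qed

lemma scalar_prod_gram:
  fixes A :: "real mat"
  assumes "A \<in> carrier_mat m n" "v \<in> carrier_vec n" "w \<in> carrier_vec n"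
  shows "v \<bullet> ((transpose_mat A * A) *\<^sub>v w) = (A *\<^sub>v v) \<bullet> (A *\<^sub>v w)"
proof -
  have "v \<bullet> ((transpose_mat A * A) *\<^sub>v w) = v \<bullet> (transpose_mat A *\<^sub>v (A *\<^sub>v w))"
    using assms by (subst assoc_mult_mat_vec) auto
  also have "\<dots> = (transpose_mat (transpose_mat A) *\<^sub>v v) \<bullet> (A *\<^sub>v w)"
    by (rule transpose_vec_mult_scalar[symmetric]) (use assms in auto)
  finally show ?thesis by simp
qed

lemma symmetric_scalar_prod:
  fixes A :: "'a :: comm_semiring_0 mat"
  assumes "A \<in> carrier_mat n n" "transpose_mat A = A" "v \<in> carrier_vec n" "w \<in> carrier_vec n"
  shows "(A *\<^sub>v v) \<bullet> w = v \<bullet> (A *\<^sub>v w)"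
  using transpose_vec_mult_scalar[OF assms(1) assms(4) assms(3)] assms(2) by simp

lemma symmetric_pow_mat:
  fixes A :: "'a :: comm_semiring_1 mat"
  assumes "A \<in> carrier_mat n n" "transpose_mat A = A"
  shows "transpose_mat (A ^\<^sub>m k) = A ^\<^sub>m k"
proof (induction k)
  case (Suc k)
  have "transpose_mat (A ^\<^sub>m Suc k) = A * A ^\<^sub>m k"
    using assms Suc by (simp add: transpose_mult[of _ n n _ n])
  \<comment> \<open>Powers grow on the right, but transposition moves the new factor to the left, so
    \<open>A\<close> must be commuted past its own power.\<close>
  also have "\<dots> = A ^\<^sub>m k * A"
  proof (induction k)
    case (Suc k)
    then show ?case using assms(1) by (simp add: assoc_mult_mat[symmetric, of _ n n _ n _ n])
  qed (use assms(1) in auto)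
  finally show ?case by simp
qed (use assms in auto)

lemma pow_mat_add:
  fixes A :: "'a :: semiring_1 mat"
  assumes "A \<in> carrier_mat n n"
  shows "A ^\<^sub>m (k + l) = A ^\<^sub>m k * A ^\<^sub>m l"
proof (induction l)
  case (Suc l)
  then show ?case
    using assms by (simp add: assoc_mult_mat[of _ n n _ n _ n])
qed (use assms in auto)

section \<open>Eigenvalues and quadratic forms of symmetric matrices\<close>

text \<open>This links the spectral radius, which is complex, to real eigenvalues. For an
  eigenvector x + iy, symmetry equates the products of Ax with y and of x with Ay, which forces Im z
  (|x|^2 + |y|^2) = 0. Then x and y both satisfy the real eigenvalue equation, and one of them is
  nonzero.\<close>

lemma symmetric_complex_eigenvalue:
  fixes A :: "real mat"
  assumes A: "A \<in> carrier_mat n n" and sym: "transpose_mat A = A"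
    and ev: "eigenvalue (map_mat complex_of_real A) z"
  shows "Im z = 0" and "eigenvalue A (Re z)"
proof -
  let ?C = "map_mat complex_of_real A"
  obtain v where v: "v \<in> carrier_vec n" "v \<noteq> 0\<^sub>v n" "?C *\<^sub>v v = z \<cdot>\<^sub>v v"
    using ev A unfolding eigenvalue_def eigenvector_def by auto
  define x where "x = map_vec Re v"
  define y where "y = map_vec Im v"
  have xy: "x \<in> carrier_vec n" "y \<in> carrier_vec n" using v(1) by (auto simp: x_def y_def)
  have entry: "(?C *\<^sub>v v) $ i = Complex ((A *\<^sub>v x) $ i) ((A *\<^sub>v y) $ i)" if "i < n" for i
    using that A v(1)
    by (simp add: scalar_prod_def x_def y_def complex_eq_iff)
  have Ax: "A *\<^sub>v x = Re z \<cdot>\<^sub>v x - Im z \<cdot>\<^sub>v y"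
  proof (rule eq_vecI)
    fix i assume "i < dim_vec (Re z \<cdot>\<^sub>v x - Im z \<cdot>\<^sub>v y)"
    then have i: "i < n" using xy by auto
    from entry[OF i] v(3) have "z * v $ i = Complex ((A *\<^sub>v x) $ i) ((A *\<^sub>v y) $ i)"
      using i v(1) by simp
    then have "Re (z * v $ i) = (A *\<^sub>v x) $ i" by simp
    then show "(A *\<^sub>v x) $ i = (Re z \<cdot>\<^sub>v x - Im z \<cdot>\<^sub>v y) $ i"
      using i v(1) by (simp add: x_def y_def)
  qed (use A xy in auto)
  have Ay: "A *\<^sub>v y = Re z \<cdot>\<^sub>v y + Im z \<cdot>\<^sub>v x"
  proof (rule eq_vecI)
    fix i assume "i < dim_vec (Re z \<cdot>\<^sub>v y + Im z \<cdot>\<^sub>v x)"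
    then have i: "i < n" using xy by auto
    from entry[OF i] v(3) have "z * v $ i = Complex ((A *\<^sub>v x) $ i) ((A *\<^sub>v y) $ i)"
      using i v(1) by simp
    then have "Im (z * v $ i) = (A *\<^sub>v y) $ i" by simp
    then show "(A *\<^sub>v y) $ i = (Re z \<cdot>\<^sub>v y + Im z \<cdot>\<^sub>v x) $ i"
      using i v(1) by (simp add: x_def y_def)
  qed (use A xy in auto)
  have nz: "x \<noteq> 0\<^sub>v n \<or> y \<noteq> 0\<^sub>v n"
  proof (rule ccontr)
    assume "\<not> ?thesis"
    then have h: "x = 0\<^sub>v n" "y = 0\<^sub>v n" by auto
    have "v = 0\<^sub>v n"
    proof (rule eq_vecI)
      fix i assume "i < dim_vec (0\<^sub>v n :: complex vec)"
      then have i: "i < n" by simp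
      have "x $ i = 0" "y $ i = 0" using h i by auto
      then show "v $ i = 0\<^sub>v n $ i" using i v(1) by (simp add: x_def y_def complex_eq_iff)
    qed (use v in auto)
    with v(2) show False ..
  qed
  have "(A *\<^sub>v x) \<bullet> y = x \<bullet> (A *\<^sub>v y)" by (rule symmetric_scalar_prod[OF A sym xy])
  then have "Im z * (x \<bullet> x + y \<bullet> y) = 0"
    unfolding Ax Ay using xy
    by (simp add: minus_scalar_prod_distrib[of _ n] scalar_prod_add_distrib[of _ n] algebra_simps)
  moreover have "x \<bullet> x + y \<bullet> y \<noteq> 0"
    using nz scalar_prod_self_ge_0[of x] scalar_prod_self_ge_0[of y]
      scalar_prod_self_eq_0_iff[OF xy(1)] scalar_prod_self_eq_0_iff[OF xy(2)] by linarith
  ultimately show im: "Im z = 0" by simp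
  have "A *\<^sub>v x = Re z \<cdot>\<^sub>v x" "A *\<^sub>v y = Re z \<cdot>\<^sub>v y"
    unfolding Ax Ay im using xy by auto
  then show "eigenvalue A (Re z)"
    using nz xy A unfolding eigenvalue_def eigenvector_def by auto
qed

lemma exponential_exceeds_polynomial:
  fixes c a b :: real
  assumes "1 < c"
  shows "\<forall>\<^sub>F k in sequentially. a + b * real k ^ d < c ^ k"
  using assms by real_asymp

text \<open>
  If the Rayleigh quotient at \<open>v\<close> were some \<open>c > 1\<close>, then by Cauchy--Schwarz
  \<open>v \<bullet> A\<^sup>k v\<close> would grow at least like \<open>c\<^sup>k\<close> along the powers \<open>k\<close> of two, whereas a spectral radius
  of at most 1 only allows polynomial growth of the entries of \<open>A\<^sup>k\<close>.
\<close>
lemma symmetric_quadratic_form_le: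
  fixes A :: "real mat"
  assumes A: "A \<in> carrier_mat n n" and sym: "transpose_mat A = A"
    and ev: "\<And>e. eigenvalue A e \<Longrightarrow> \<bar>e\<bar> \<le> 1"
    and v: "v \<in> carrier_vec n"
  shows "v \<bullet> (A *\<^sub>v v) \<le> v \<bullet> v"
proof (rule ccontr)
  assume "\<not> ?thesis"
  then have less: "v \<bullet> v < v \<bullet> (A *\<^sub>v v)" by simp
  have v0: "v \<noteq> 0\<^sub>v n" using less A by auto
  \<comment> \<open>A matrix of size 0 has an empty spectrum, over which the spectral radius is not
    a maximum.\<close>
  then have n: "n > 0" using v by (intro gr0I) auto
  have vv: "v \<bullet> v > 0"
    using scalar_prod_self_ge_0[of v] scalar_prod_self_eq_0_iff[OF v] v0 by linarith
  \<comment> \<open>Dividing by \<open>v \<bullet> v\<close> turns Cauchy-Schwarz for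
    \<open>v\<close> and \<open>A ^\<^sub>m k *\<^sub>v v\<close> into t(k)^2 \<le> t(2k), without a
    constant that would accumulate under repeated squaring.\<close>
  define t where "t k = v \<bullet> (A ^\<^sub>m k *\<^sub>v v) / (v \<bullet> v)" for k
  define c where "c = t 1"
  have c: "c > 1" using less vv A by (simp add: c_def t_def)
  have t_double: "(t k)\<^sup>2 \<le> t (2 * k)" for k
  proof -
    have Ak: "A ^\<^sub>m k \<in> carrier_mat n n" using A by simp
    have "v \<bullet> (A ^\<^sub>m (2 * k) *\<^sub>v v) = (A ^\<^sub>m k *\<^sub>v v) \<bullet> (A ^\<^sub>m k *\<^sub>v v)"
      using scalar_prod_gram[OF Ak v v] symmetric_pow_mat[OF A sym, of k] pow_mat_add[OF A, of k k]
      by (simp add: mult_2)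
    then show ?thesis
      using scalar_prod_Cauchy_Schwarz[OF v, of "A ^\<^sub>m k *\<^sub>v v"] Ak vv v
      by (simp add: t_def power2_eq_square field_simps)
  qed
  have t_pow: "c ^ (2 ^ j) \<le> t (2 ^ j)" for j
  proof (induction j)
    case (Suc j)
    have "c ^ (2 ^ Suc j) = (c ^ (2 ^ j))\<^sup>2" by (simp add: power_mult[symmetric] mult.commute)
    also have "\<dots> \<le> (t (2 ^ j))\<^sup>2" using Suc c by (intro power_mono) auto
    also have "\<dots> \<le> t (2 ^ Suc j)" using t_double by simp
    finally show ?case .
  qed (simp add: c_def)
  let ?C = "map_mat complex_of_real A"
  have C: "?C \<in> carrier_mat n n" using A by simp
  have "spectral_radius ?C \<le> 1"
  proof -
    obtain z where z: "eigenvalue ?C z" "spectral_radius ?C = norm z"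
      using spectral_radius_mem_max(1)[OF C n] unfolding spectrum_def by auto
    have "norm z = \<bar>Re z\<bar>"
      using symmetric_complex_eigenvalue(1)[OF A sym z(1)] by (simp add: cmod_def)
    with ev[OF symmetric_complex_eigenvalue(2)[OF A sym z(1)]] z(2) show ?thesis by simp
  qed
  from spectral_radius_jnf_norm_bound_le_1_upper_triangular[OF C this]
  obtain c1 c2 where bound: "\<And>k. norm_bound (?C ^\<^sub>m k) (c1 + c2 * of_nat k ^ (n - 1))" by auto
  \<comment> \<open>A common bound on the entries of the power, multiplied by \<open>s\<close>,
    bounds \<open>t\<close>.\<close>
  define s where "s = (\<Sum>i = 0..<n. \<Sum>j = 0..<n. \<bar>v $ i\<bar> * \<bar>v $ j\<bar>) / (v \<bullet> v)"
  have t_le: "t k \<le> s * c1 + s * c2 * real k ^ (n - 1)" for k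
  proof -
    let ?b = "c1 + c2 * real k ^ (n - 1)"
    have Ak: "A ^\<^sub>m k \<in> carrier_mat n n" using A by simp
    have entry: "\<bar>(A ^\<^sub>m k) $$ (i, j)\<bar> \<le> ?b" if "i < n" "j < n" for i j
    proof -
      have "?C ^\<^sub>m k = map_mat complex_of_real (A ^\<^sub>m k)"
        by (rule of_real_hom.mat_hom_pow[OF A, symmetric])
      then show ?thesis using bound[of k] that A Ak unfolding norm_bound_def by auto
    qed
    have "v \<bullet> (A ^\<^sub>m k *\<^sub>v v) = (\<Sum>i = 0..<n. \<Sum>j = 0..<n. v $ i * ((A ^\<^sub>m k) $$ (i, j) * v $ j))"
      using A Ak v by (simp add: scalar_prod_def sum_distrib_left cong: sum.cong_simp)
    also have "\<dots> \<le> (\<Sum>i = 0..<n. \<Sum>j = 0..<n. \<bar>v $ i\<bar> * \<bar>v $ j\<bar> * ?b)"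
    proof (intro sum_mono)
      fix i j assume ij: "i \<in> {0..<n}" "j \<in> {0..<n}"
      have "v $ i * ((A ^\<^sub>m k) $$ (i, j) * v $ j) \<le> \<bar>v $ i\<bar> * \<bar>v $ j\<bar> * \<bar>(A ^\<^sub>m k) $$ (i, j)\<bar>"
        using abs_ge_self[of "v $ i * ((A ^\<^sub>m k) $$ (i, j) * v $ j)"]
        by (simp add: abs_mult mult.assoc mult.commute[of "\<bar>v $ j\<bar>"])
      also have "\<dots> \<le> \<bar>v $ i\<bar> * \<bar>v $ j\<bar> * ?b"
        using entry ij by (intro mult_left_mono) auto
      finally show "v $ i * ((A ^\<^sub>m k) $$ (i, j) * v $ j) \<le> \<bar>v $ i\<bar> * \<bar>v $ j\<bar> * ?b" .
    qed
    also have "\<dots> = s * (v \<bullet> v) * ?b"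
    proof -
      have "s * (v \<bullet> v) = (\<Sum>i = 0..<n. \<Sum>j = 0..<n. \<bar>v $ i\<bar> * \<bar>v $ j\<bar>)"
        using vv by (simp add: s_def)
      then show ?thesis by (simp add: sum_distrib_right)
    qed
    finally show ?thesis using vv by (simp add: t_def field_simps)
  qed
  obtain K where K: "\<And>k. k \<ge> K \<Longrightarrow> s * c1 + s * c2 * real k ^ (n - 1) < c ^ k"
    using exponential_exceeds_polynomial[OF c] unfolding eventually_sequentially by blast
  have "K \<le> 2 ^ K" by (simp add: less_imp_le)
  from K[OF this] t_le[of "2 ^ K"] t_pow[of K] show False by simp
qed

section \<open>Contractions and the spectral norm\<close>

text \<open>Squared lengths avoid square roots, and quantifying over vectors makes closure under
  products, transposes and blocks accessible.\<close>

definition contraction_mat :: "real mat \<Rightarrow> bool" where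
  "contraction_mat A \<longleftrightarrow>
     (\<forall>v \<in> carrier_vec (dim_col A). (A *\<^sub>v v) \<bullet> (A *\<^sub>v v) \<le> v \<bullet> v)"

lemma contraction_matD:
  "contraction_mat A \<Longrightarrow> A \<in> carrier_mat m n \<Longrightarrow> v \<in> carrier_vec n \<Longrightarrow>
     (A *\<^sub>v v) \<bullet> (A *\<^sub>v v) \<le> v \<bullet> v"
  by (auto simp: contraction_mat_def)

lemma spectral_norm_le_1_iff_contraction: "spectral_norm A \<le> 1 \<longleftrightarrow> contraction_mat A"
proof -
  define m n where "m = dim_row A" and "n = dim_col A"
  have A: "A \<in> carrier_mat m n" by (simp add: m_def n_def)
  let ?G = "transpose_mat A * A"
  have G: "?G \<in> carrier_mat n n" using A by auto
  have sym: "transpose_mat ?G = ?G" using A by (simp add: transpose_mult[of _ n m _ n])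
  \<comment> \<open>The elements of \<open>proots\<close> are exactly the roots only for a nonzero
    polynomial. The 0 inserted under \<open>Max\<close> is harmless for the bound 1.\<close>
  have "char_poly ?G \<noteq> 0" using degree_monic_char_poly[OF G] by auto
  then have "spectral_norm A \<le> 1 \<longleftrightarrow> (\<forall>e. poly (char_poly ?G) e = 0 \<longrightarrow> sqrt e \<le> 1)"
    by (auto simp: spectral_norm_def singular_values_def poly_roots_finite)
  also have "\<dots> \<longleftrightarrow> (\<forall>e. eigenvalue ?G e \<longrightarrow> e \<le> 1)"
    by (simp add: eigenvalue_root_char_poly[OF G])
  also have "\<dots> \<longleftrightarrow> contraction_mat A"
  proof
    assume le1: "\<forall>e. eigenvalue ?G e \<longrightarrow> e \<le> 1"
    \<comment> \<open>The bound on quadratic forms asks for absolute values; Gram eigenvalues are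
      nonnegative because e |v|^2 = |Av|^2 on an eigenvector.\<close>
    have "\<bar>e\<bar> \<le> 1" if e: "eigenvalue ?G e" for e
    proof -
      obtain v where v: "v \<in> carrier_vec n" "v \<noteq> 0\<^sub>v n" "?G *\<^sub>v v = e \<cdot>\<^sub>v v"
        using e G unfolding eigenvalue_def eigenvector_def by auto
      have "e * (v \<bullet> v) = (A *\<^sub>v v) \<bullet> (A *\<^sub>v v)"
        using scalar_prod_gram[OF A v(1) v(1)] v by simp
      moreover have "v \<bullet> v > 0"
        using scalar_prod_self_ge_0[of v] scalar_prod_self_eq_0_iff[OF v(1)] v(2) by linarith
      ultimately have "e \<ge> 0"
        using scalar_prod_self_ge_0[of "A *\<^sub>v v"] by (metis not_less zero_le_mult_iff)
      then show ?thesis using le1 e by auto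
    qed
    then show "contraction_mat A"
      using symmetric_quadratic_form_le[OF G sym] scalar_prod_gram[OF A]
      unfolding contraction_mat_def n_def[symmetric] by auto
  next
    assume contr: "contraction_mat A"
    show "\<forall>e. eigenvalue ?G e \<longrightarrow> e \<le> 1"
    proof (intro allI impI)
      fix e assume e: "eigenvalue ?G e"
      obtain v where v: "v \<in> carrier_vec n" "v \<noteq> 0\<^sub>v n" "?G *\<^sub>v v = e \<cdot>\<^sub>v v"
        using e G unfolding eigenvalue_def eigenvector_def by auto
      have "e * (v \<bullet> v) \<le> 1 * (v \<bullet> v)"
        using scalar_prod_gram[OF A v(1) v(1)] v contraction_matD[OF contr A v(1)] by simp
      moreover have "v \<bullet> v > 0"
        using scalar_prod_self_ge_0[of v] scalar_prod_self_eq_0_iff[OF v(1)] v(2) by linarith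
      ultimately show "e \<le> 1" by (metis mult_le_cancel_right not_less)
    qed
  qed
  finally show ?thesis .
qed

section \<open>Orthogonal matrices and closure properties of contractions\<close>

lemma orthogonal_matricesD:
  assumes "Q \<in> orthogonal_matrices n"
  shows "Q \<in> carrier_mat n n" "transpose_mat Q * Q = 1\<^sub>m n" "Q * transpose_mat Q = 1\<^sub>m n"
    "transpose_mat Q \<in> orthogonal_matrices n"
  using assms by (auto simp: orthogonal_matrices_def)

text \<open>The four cancellations share their hypotheses, so a use of one of them fills the matrix
  that does not occur in it with any matrix of suitable shape, usually
  \<open>1\<^sub>m n\<close>.\<close>

lemma orthogonal_mult_cancel:
  assumes "Q \<in> orthogonal_matrices n" "A \<in> carrier_mat n m" "B \<in> carrier_mat m n"
  shows "transpose_mat Q * (Q * A) = A" "Q * (transpose_mat Q * A) = A"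
    "B * Q * transpose_mat Q = B" "B * transpose_mat Q * Q = B"
proof -
  note Q = orthogonal_matricesD[OF assms(1)]
  have T: "transpose_mat Q \<in> carrier_mat n n" using Q(1) by simp
  show "transpose_mat Q * (Q * A) = A"
    using Q assms by (simp add: assoc_mult_mat[OF T Q(1) assms(2), symmetric])
  show "Q * (transpose_mat Q * A) = A"
    using Q assms by (simp add: assoc_mult_mat[OF Q(1) T assms(2), symmetric])
  show "B * Q * transpose_mat Q = B"
    using Q assms by (simp add: assoc_mult_mat[OF assms(3) Q(1) T])
  show "B * transpose_mat Q * Q = B"
    using Q assms by (simp add: assoc_mult_mat[OF assms(3) T Q(1)])
qed

text \<open>For w = A^T v one has |w|^2 = v . Aw, hence |w|^4 \<le> |v|^2 |w|^2 by Cauchy-Schwarz,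
  and |w|^2 cancels unless it is 0. This transfers statements about columns to rows.\<close>

lemma contraction_mat_transpose:
  assumes "contraction_mat A"
  shows "contraction_mat (transpose_mat A)"
  unfolding contraction_mat_def
proof
  define m n where "m = dim_row A" and "n = dim_col A"
  have A: "A \<in> carrier_mat m n" by (simp add: m_def n_def)
  fix v :: "real vec" assume "v \<in> carrier_vec (dim_col (transpose_mat A))"
  then have v: "v \<in> carrier_vec m" by (simp add: m_def)
  define w where "w = transpose_mat A *\<^sub>v v"
  have w: "w \<in> carrier_vec n" using A v by (simp add: w_def)
  have Aw: "A *\<^sub>v w \<in> carrier_vec m" using A w by simp
  have "w \<bullet> w = v \<bullet> (A *\<^sub>v w)"
    using transpose_vec_mult_scalar[OF A w v] by (simp add: w_def)
  then have "(w \<bullet> w)\<^sup>2 \<le> (v \<bullet> v) * ((A *\<^sub>v w) \<bullet> (A *\<^sub>v w))"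
    using scalar_prod_Cauchy_Schwarz[OF v Aw] by simp
  also have "\<dots> \<le> (v \<bullet> v) * (w \<bullet> w)"
    by (intro mult_left_mono contraction_matD[OF assms A w] scalar_prod_self_ge_0)
  finally have "(w \<bullet> w) * (w \<bullet> w) \<le> (v \<bullet> v) * (w \<bullet> w)" by (simp add: power2_eq_square)
  then show "w \<bullet> w \<le> v \<bullet> v"
    using scalar_prod_self_ge_0[of w] scalar_prod_self_ge_0[of v]
    by (cases "w \<bullet> w = 0") (auto simp: mult_le_cancel_right)
qed

lemma contraction_mat_mult:
  assumes "A \<in> carrier_mat m n" "B \<in> carrier_mat n k" "contraction_mat A" "contraction_mat B"
  shows "contraction_mat (A * B)"
  unfolding contraction_mat_def
proof
  fix v :: "real vec" assume "v \<in> carrier_vec (dim_col (A * B))"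
  then have v: "v \<in> carrier_vec k" using assms(2) by simp
  have Bv: "B *\<^sub>v v \<in> carrier_vec n" using assms(2) v by simp
  show "((A * B) *\<^sub>v v) \<bullet> ((A * B) *\<^sub>v v) \<le> v \<bullet> v"
    using contraction_matD[OF assms(3,1) Bv] contraction_matD[OF assms(4,2) v] assms(1,2) v
    by simp
qed

lemma orthogonal_contraction_mat:
  assumes "Q \<in> orthogonal_matrices n"
  shows "contraction_mat Q"
  using scalar_prod_gram[of Q n n] orthogonal_matricesD[OF assms]
  unfolding contraction_mat_def by auto

lemma contraction_mat_uminus: "contraction_mat (- A) \<longleftrightarrow> contraction_mat A"
proof -
  have "(- A) *\<^sub>v v = - (A *\<^sub>v v)" if "v \<in> carrier_vec (dim_col A)" for v
    using that by (intro eq_vecI) (auto simp: scalar_prod_def sum_negf)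
  then show ?thesis by (simp add: contraction_mat_def)
qed

section \<open>Entries and blocks of contractions\<close>

lemma contraction_mat_col_sum:
  assumes "contraction_mat A" "A \<in> carrier_mat m n" "j < n"
  shows "(\<Sum>i = 0..<m. (A $$ (i, j))\<^sup>2) \<le> 1"
proof -
  have "(A *\<^sub>v unit_vec n j) \<bullet> (A *\<^sub>v unit_vec n j) = (\<Sum>i = 0..<m. (A $$ (i, j))\<^sup>2)"
    using assms(2,3) by (simp add: scalar_prod_def[of "A *\<^sub>v _"] power2_eq_square)
  then show ?thesis
    using contraction_matD[OF assms(1,2), of "unit_vec n j"] assms(3) by simp
qed

lemma contraction_mat_entry:
  assumes "contraction_mat A" "A \<in> carrier_mat m n" "i < m" "j < n"
  shows "\<bar>A $$ (i, j)\<bar> \<le> 1"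
proof -
  have "(A $$ (i, j))\<^sup>2 \<le> (\<Sum>i = 0..<m. (A $$ (i, j))\<^sup>2)"
    using assms by (intro member_le_sum[where f = "\<lambda>i. (A $$ (i, j))\<^sup>2"]) auto
  also have "\<dots> \<le> 1" by (rule contraction_mat_col_sum[OF assms(1,2,4)])
  finally show ?thesis by (simp add: abs_square_le_1)
qed

lemma contraction_mat_col_extreme:
  assumes "contraction_mat A" "A \<in> carrier_mat m n" "i < m" "j < n" "\<bar>A $$ (i, j)\<bar> = 1"
    "k < m" "k \<noteq> i"
  shows "A $$ (k, j) = 0"
proof -
  have "(A $$ (i, j))\<^sup>2 + (A $$ (k, j))\<^sup>2 = (\<Sum>l \<in> {i, k}. (A $$ (l, j))\<^sup>2)"
    using assms by simp
  also have "\<dots> \<le> (\<Sum>l = 0..<m. (A $$ (l, j))\<^sup>2)"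
    using assms by (intro sum_mono2) auto
  also have "\<dots> \<le> 1" by (rule contraction_mat_col_sum[OF assms(1,2,4)])
  finally have "1 + (A $$ (k, j))\<^sup>2 \<le> 1" using assms(5) by (metis power2_abs one_power2)
  then show ?thesis by simp
qed

text \<open>The identity block preserves length, so (a, d) is sent to a vector of squared length
  |a|^2 + |Wd|^2. Comparing with |a|^2 + |d|^2 gives one direction, and a = 0 the other.\<close>

lemma contraction_mat_four_block:
  assumes W: "W \<in> carrier_mat k l"
  shows "contraction_mat (four_block_mat (1\<^sub>m r) (0\<^sub>m r l) (0\<^sub>m k r) W) \<longleftrightarrow> contraction_mat W"
    (is "contraction_mat ?B \<longleftrightarrow> _")
proof -
  have B: "?B \<in> carrier_mat (r + k) (r + l)" using W by simp
  have norm: "(?B *\<^sub>v (a @\<^sub>v d)) \<bullet> (?B *\<^sub>v (a @\<^sub>v d)) = a \<bullet> a + (W *\<^sub>v d) \<bullet> (W *\<^sub>v d)"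
    if ad: "a \<in> carrier_vec r" "d \<in> carrier_vec l" for a d
  proof -
    have "?B *\<^sub>v (a @\<^sub>v d) = a @\<^sub>v (W *\<^sub>v d)"
      using W ad by (subst four_block_mat_mult_vec[of _ r r _ l _ k]) auto
    then show ?thesis using W ad by (simp add: scalar_prod_append[of _ r _ k])
  qed
  show ?thesis
  proof
    assume c: "contraction_mat ?B"
    show "contraction_mat W"
      unfolding contraction_mat_def
    proof
      fix d :: "real vec" assume "d \<in> carrier_vec (dim_col W)"
      then have d: "d \<in> carrier_vec l" using W by simp
      show "(W *\<^sub>v d) \<bullet> (W *\<^sub>v d) \<le> d \<bullet> d"
        using contraction_matD[OF c B, of "0\<^sub>v r @\<^sub>v d"] norm[OF _ d, of "0\<^sub>v r"] d
        by (simp add: scalar_prod_append[of _ r _ l])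
    qed
  next
    assume c: "contraction_mat W"
    show "contraction_mat ?B"
      unfolding contraction_mat_def
    proof
      fix v :: "real vec" assume "v \<in> carrier_vec (dim_col ?B)"
      then have v: "v \<in> carrier_vec (r + l)" using W by simp
      define a d where "a = vec_first v r" and "d = vec_last v l"
      have ad: "a \<in> carrier_vec r" "d \<in> carrier_vec l" by (auto simp: a_def d_def)
      have "v = a @\<^sub>v d" using v by (simp add: a_def d_def)
      then show "(?B *\<^sub>v v) \<bullet> (?B *\<^sub>v v) \<le> v \<bullet> v"
        using norm[OF ad] contraction_matD[OF c W ad(2)] ad
        by (simp add: scalar_prod_append[of _ r _ l])
    qed
  qed
qed

lemma contraction_mat_diag_minus_one:
  assumes Z: "Z \<in> carrier_mat n n" and c: "contraction_mat Z" and r: "r \<le> n"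
    and diag: "\<And>i. i < r \<Longrightarrow> Z $$ (i, i) = - 1"
  obtains W where "W \<in> carrier_mat (n - r) (n - r)"
    "Z = - four_block_mat (1\<^sub>m r) (0\<^sub>m r (n - r)) (0\<^sub>m (n - r) r) W"
proof
  \<comment> \<open>The entries are negated because the whole block matrix carries a minus
    sign.\<close>
  define W where "W = mat (n - r) (n - r) (\<lambda>(i, j). - Z $$ (i + r, j + r))"
  show "W \<in> carrier_mat (n - r) (n - r)" by (simp add: W_def)
  have col: "Z $$ (i, j) = 0" if "i < n" "j < r" "i \<noteq> j" for i j
    using contraction_mat_col_extreme[OF c Z, of j j i] diag[of j] that r by simp
  have row: "Z $$ (j, i) = 0" if "i < n" "j < r" "i \<noteq> j" for i j
    using contraction_mat_col_extreme[OF contraction_mat_transpose[OF c], of n n j j i]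
      diag[of j] that r Z by simp
  show "Z = - four_block_mat (1\<^sub>m r) (0\<^sub>m r (n - r)) (0\<^sub>m (n - r) r) W"
    using Z r diag col row by (intro eq_matI) (auto simp: W_def)
qed

section \<open>The objective in singular coordinates\<close>

lemma mat_trace_mult_comm:
  assumes "A \<in> carrier_mat n m" "B \<in> carrier_mat m n"
  shows "mat_trace (A * B) = mat_trace (B * A)"
proof -
  have "mat_trace (A * B) = (\<Sum>i<n. \<Sum>j<m. A $$ (i, j) * B $$ (j, i))"
    using assms by (simp add: mat_trace_def scalar_prod_def atLeast0LessThan cong: sum.cong_simp)
  also have "\<dots> = (\<Sum>j<m. \<Sum>i<n. B $$ (j, i) * A $$ (i, j))"
    by (subst sum.swap) (simp add: mult.commute)
  also have "\<dots> = mat_trace (B * A)"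
    using assms by (simp add: mat_trace_def scalar_prod_def atLeast0LessThan cong: sum.cong_simp)
  finally show ?thesis .
qed

lemma diagonal_mult_entry:
  fixes S :: "real mat"
  assumes "diagonal_mat S" "S \<in> carrier_mat n n" "A \<in> carrier_mat n m" "B \<in> carrier_mat m n"
    "i < n" "j < m"
  shows "(S * A) $$ (i, j) = S $$ (i, i) * A $$ (i, j)"
    and "(B * S) $$ (j, i) = B $$ (j, i) * S $$ (i, i)"
proof -
  have "(\<Sum>k = 0..<n. S $$ (i, k) * A $$ (k, j))
      = (\<Sum>k = 0..<n. if k = i then S $$ (i, i) * A $$ (i, j) else 0)"
    using assms by (intro sum.cong) (auto simp: diagonal_mat_def)
  then show "(S * A) $$ (i, j) = S $$ (i, i) * A $$ (i, j)"
    using assms by (simp add: scalar_prod_def cong: sum.cong_simp)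
  have "(\<Sum>k = 0..<n. B $$ (j, k) * S $$ (k, i))
      = (\<Sum>k = 0..<n. if k = i then B $$ (j, i) * S $$ (i, i) else 0)"
    using assms by (intro sum.cong) (auto simp: diagonal_mat_def)
  then show "(B * S) $$ (j, i) = B $$ (j, i) * S $$ (i, i)"
    using assms by (simp add: scalar_prod_def cong: sum.cong_simp)
qed

lemma diagonal_transpose:
  "diagonal_mat S \<Longrightarrow> S \<in> carrier_mat n n \<Longrightarrow> transpose_mat S = S"
  by (intro eq_matI) (auto simp: diagonal_mat_def, metis)

text \<open>Commuting \<open>V\<close> under the trace from the front to the end gathers
  \<open>Y\<close> into \<open>U\<^sup>T Y V\<close>, of which the diagonal factor \<open>S\<close>
  sees only the diagonal.\<close>

lemma frob_inner_svd:
  assumes U: "U \<in> carrier_mat n n" and V: "V \<in> carrier_mat n n"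
    and S: "S \<in> carrier_mat n n" "diagonal_mat S" and Y: "Y \<in> carrier_mat n n"
  shows "frob_inner (U * S * transpose_mat V) Y
    = (\<Sum>i<n. S $$ (i, i) * (transpose_mat U * Y * V) $$ (i, i))"
proof -
  let ?Z = "transpose_mat U * Y * V"
  have "transpose_mat (U * S * transpose_mat V) * Y = V * (S * (transpose_mat U * Y))"
    using U V S Y
    by (simp add: transpose_mult[of _ n n _ n] diagonal_transpose[of S n] assoc_mult_mat[of _ n n _ n _ n])
  then have "frob_inner (U * S * transpose_mat V) Y = mat_trace (S * (transpose_mat U * Y) * V)"
    unfolding frob_inner_def using U V S Y by (simp add: mat_trace_mult_comm[of V n n])
  also have "S * (transpose_mat U * Y) * V = S * ?Z"
    using U V S Y by (simp add: assoc_mult_mat[of _ n n _ n _ n])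
  also have "mat_trace (S * ?Z) = (\<Sum>i<n. S $$ (i, i) * ?Z $$ (i, i))"
    unfolding mat_trace_def
  proof (rule sum.cong)
    have Z: "?Z \<in> carrier_mat n n" using U V Y by simp
    fix i assume "i \<in> {..<n}"
    then show "(S * ?Z) $$ (i, i) = S $$ (i, i) * ?Z $$ (i, i)"
      by (intro diagonal_mult_entry(1)[OF S(2,1) Z Z]) auto
  qed (use S in auto)
  finally show ?thesis .
qed

section \<open>Gram matrices and the nuclear norm\<close>

text \<open>The left factor \<open>U\<close> cancels, so \<open>V\<close> diagonalises the Gram
  matrix. Both the nuclear norm and the square root inside \<open>msign\<close> are read off from
  this form.\<close>

lemma gram_svd:
  assumes U: "U \<in> orthogonal_matrices n" and V: "V \<in> orthogonal_matrices n"
    and S: "S \<in> carrier_mat n n" "diagonal_mat S"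
  shows "transpose_mat (U * S * transpose_mat V) * (U * S * transpose_mat V)
    = V * (S * S) * transpose_mat V"
proof -
  note U' = orthogonal_matricesD[OF U] and V' = orthogonal_matricesD[OF V]
  have "transpose_mat (U * S * transpose_mat V) * (U * S * transpose_mat V)
    = V * (S * (transpose_mat U * (U * (S * transpose_mat V))))"
    using U' V' S
    by (simp add: transpose_mult[of _ n n _ n] diagonal_transpose[of S n] assoc_mult_mat[of _ n n _ n _ n])
  also have "\<dots> = V * (S * (S * transpose_mat V))"
    using U' V' S by (subst orthogonal_mult_cancel(1)[OF U, of _ n "1\<^sub>m n"]) auto
  also have "\<dots> = V * (S * S) * transpose_mat V"
    using V' S by (simp add: assoc_mult_mat[of _ n n _ n _ n])
  finally show ?thesis .
qed

lemma proots_prod_linear_factors: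
  "proots (\<Prod>a \<leftarrow> as. [:- a, 1:]) = mset (as :: 'a :: idom list)"
proof (induction as)
  case (Cons a as)
  have "(\<Prod>a \<leftarrow> as. [:- a, 1:]) \<noteq> 0" by (auto simp: prod_list_zero_iff)
  then have "proots (\<Prod>a \<leftarrow> a # as. [:- a, 1:]) = proots [:- a, 1:] + proots (\<Prod>a \<leftarrow> as. [:- a, 1:])"
    unfolding list.map prod_list.Cons by (intro proots_mult) auto
  then show ?case using Cons by simp
qed simp

text \<open>The Gram matrix is similar to \<open>S * S\<close>, whose characteristic polynomial
  splits into linear factors with the squared diagonal entries as roots, multiplicities included.
  Nonnegativity lets \<open>sqrt\<close> undo the squares.\<close>

lemma nuclear_norm_svd:
  assumes U: "U \<in> orthogonal_matrices n" and V: "V \<in> orthogonal_matrices n"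
    and S: "S \<in> carrier_mat n n" "diagonal_mat S" "\<And>i. i < n \<Longrightarrow> 0 \<le> S $$ (i, i)"
  shows "nuclear_norm (U * S * transpose_mat V) = (\<Sum>i<n. S $$ (i, i))"
proof -
  let ?N = "U * S * transpose_mat V"
  note V' = orthogonal_matricesD[OF V]
  have SS: "S * S \<in> carrier_mat n n" using S by simp
  have diag: "(S * S) $$ (i, j) = (if i = j then (S $$ (i, i))\<^sup>2 else 0)" if "i < n" "j < n" for i j
    using diagonal_mult_entry(1)[OF S(2,1) S(1) S(1), of i j] that S
    by (auto simp: power2_eq_square diagonal_mat_def simp del: index_mult_mat(1))
  have "similar_mat (transpose_mat ?N * ?N) (S * S)"
    using V' S SS gram_svd[OF U V S(1,2)] by (intro similar_matI[of _ _ V "transpose_mat V" n]) auto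
  then have "char_poly (transpose_mat ?N * ?N) = char_poly (S * S)" by (rule char_poly_similar)
  also have "\<dots> = (\<Prod>a \<leftarrow> diag_mat (S * S). [:- a, 1:])"
    by (rule char_poly_upper_triangular[OF SS])
      (use diag SS in \<open>auto simp: upper_triangular_def simp del: index_mult_mat(1)\<close>)
  finally have "singular_values ?N = mset (map sqrt (diag_mat (S * S)))"
    by (simp add: singular_values_def proots_prod_linear_factors)
  also have "diag_mat (S * S) = map (\<lambda>i. (S $$ (i, i))\<^sup>2) [0..<n]"
    using diag SS by (auto simp: diag_mat_def simp del: index_mult_mat(1))
  also have "map sqrt \<dots> = map (\<lambda>i. sqrt ((S $$ (i, i))\<^sup>2)) [0..<n]" by simp
  also have "map (\<lambda>i. sqrt ((S $$ (i, i))\<^sup>2)) [0..<n] = map (\<lambda>i. S $$ (i, i)) [0..<n]"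
    using S(3) by simp
  finally have "singular_values ?N = mset (map (\<lambda>i. S $$ (i, i)) [0..<n])" .
  then have "nuclear_norm ?N = sum_list (map (\<lambda>i. S $$ (i, i)) [0..<n])"
    by (simp add: nuclear_norm_def sum_mset_sum_list del: mset_map)
  also have "\<dots> = (\<Sum>i<n. S $$ (i, i))"
    by (simp add: sum_list_distinct_conv_sum_set atLeast0LessThan)
  finally show ?thesis .
qed

section \<open>Minimisers of a linear functional on the spectral unit ball\<close>

text \<open>Provides W = 0 as an admissible block of any size, including 0 by 0, so that the set of
  optimal solutions is not empty.\<close>

lemma spectral_norm_zero_mat_le_1: "spectral_norm (0\<^sub>m m n) \<le> 1"
proof -
  have "0\<^sub>m m n *\<^sub>v v = 0\<^sub>v m" if "v \<in> carrier_vec n" for v :: "real vec"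
    using that by (intro eq_vecI) auto
  then show ?thesis
    by (simp add: spectral_norm_le_1_iff_contraction contraction_mat_def scalar_prod_self_ge_0)
qed

text \<open>Here \<open>r\<close> enters through the sign pattern of the diagonal of
  \<open>S\<close>: a positive entry pins the matching diagonal entry of
  \<open>U\<^sup>T Y V\<close>, a zero entry puts no price on it.\<close>

lemma svd_linear_minimisers:
  assumes U: "U \<in> orthogonal_matrices n" and V: "V \<in> orthogonal_matrices n"
    and S: "S \<in> carrier_mat n n" "diagonal_mat S" and r: "r \<le> n"
    and pos: "\<And>i. i < r \<Longrightarrow> 0 < S $$ (i, i)" and zero: "\<And>i. r \<le> i \<Longrightarrow> i < n \<Longrightarrow> S $$ (i, i) = 0"
    and N_def: "N = U * S * transpose_mat V"
  defines "feasible \<equiv> \<lambda>Y. Y \<in> carrier_mat n n \<and> spectral_norm Y \<le> 1"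
  shows "is_min_value (frob_inner N) feasible (- nuclear_norm N)" (is ?min)
    and "{Y. is_arg_min (frob_inner N) feasible Y} =
        {- (U * four_block_mat (1\<^sub>m r) (0\<^sub>m r (n-r)) (0\<^sub>m (n-r) r) W * transpose_mat V) | W.
           W \<in> carrier_mat (n-r) (n-r) \<and> spectral_norm W \<le> 1}" (is "?L = ?R")
proof -
  note U' = orthogonal_matricesD[OF U] and V' = orthogonal_matricesD[OF V]
  let ?B = "\<lambda>W. four_block_mat (1\<^sub>m r) (0\<^sub>m r (n-r)) (0\<^sub>m (n-r) r) W"
  let ?Z = "\<lambda>Y. transpose_mat U * Y * V"
  have nonneg: "0 \<le> S $$ (i, i)" if "i < n" for i
    using pos[of i] zero[of i] that by (cases "i < r") auto
  have nuc: "nuclear_norm N = (\<Sum>i<n. S $$ (i, i))"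
    unfolding N_def by (rule nuclear_norm_svd[OF U V S nonneg])
  have inner: "frob_inner N Y = (\<Sum>i<n. S $$ (i, i) * ?Z Y $$ (i, i))" if "Y \<in> carrier_mat n n" for Y
    unfolding N_def by (rule frob_inner_svd[OF U'(1) V'(1) S that])
  have Z: "?Z Y \<in> carrier_mat n n" "contraction_mat (?Z Y)" if "feasible Y" for Y
  proof -
    have Y: "Y \<in> carrier_mat n n" "contraction_mat Y"
      using that by (auto simp: feasible_def spectral_norm_le_1_iff_contraction)
    show "?Z Y \<in> carrier_mat n n" using U' V' Y by simp
    show "contraction_mat (?Z Y)"
    proof (rule contraction_mat_mult)
      show "contraction_mat (transpose_mat U * Y)"
        using Y U' by (intro contraction_mat_mult[of _ n n _ n] orthogonal_contraction_mat[OF U'(4)]) auto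
    qed (use U' V' Y orthogonal_contraction_mat[OF V] in auto)
  qed
  \<comment> \<open>The bound is recorded for each term, since the equality case later needs every
    single gap and not just their sum.\<close>
  have term_ge: "- S $$ (i, i) \<le> S $$ (i, i) * ?Z Y $$ (i, i)" if "feasible Y" "i < n" for Y i
  proof -
    have "- 1 \<le> ?Z Y $$ (i, i)"
      using contraction_mat_entry[OF Z(2,1)[OF that(1)] that(2,2)] by linarith
    from mult_left_mono[OF this nonneg[OF that(2)]] show ?thesis by simp
  qed
  have ge: "- nuclear_norm N \<le> frob_inner N Y" if "feasible Y" for Y
  proof -
    have "Y \<in> carrier_mat n n" using that by (simp add: feasible_def)
    moreover have "(\<Sum>i<n. - S $$ (i, i)) \<le> (\<Sum>i<n. S $$ (i, i) * ?Z Y $$ (i, i))"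
      using term_ge[OF that] by (intro sum_mono) simp
    ultimately show ?thesis using inner nuc by (simp only: sum_negf)
  qed
  \<comment> \<open>Allowing every admissible \<open>W\<close> serves twice: for the existence of a
    minimiser and for one inclusion between the two sets.\<close>
  have attained: "feasible Y \<and> frob_inner N Y = - nuclear_norm N"
    if W: "W \<in> carrier_mat (n - r) (n - r)" "spectral_norm W \<le> 1"
      and Y: "Y = - (U * ?B W * transpose_mat V)" for W Y
  proof -
    have B: "?B W \<in> carrier_mat n n" "contraction_mat (?B W)"
      using W r contraction_mat_four_block[OF W(1)] four_block_carrier_mat[of "1\<^sub>m r" r r W "n - r" "n - r"]
      by (auto simp: spectral_norm_le_1_iff_contraction)
    have "contraction_mat (U * ?B W * transpose_mat V)"
    proof (rule contraction_mat_mult[of _ n n _ n])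
      show "contraction_mat (U * ?B W)"
        using B U' by (intro contraction_mat_mult[of _ n n _ n] orthogonal_contraction_mat[OF U]) auto
      show "contraction_mat (transpose_mat V)"
        by (rule orthogonal_contraction_mat[OF V'(4)])
    qed (use U' V' B in auto)
    then have feas: "feasible Y"
      using U' V' B
      by (simp add: feasible_def Y spectral_norm_le_1_iff_contraction contraction_mat_uminus)
    have "?Z Y = - (transpose_mat U * (U * ?B W * transpose_mat V) * V)"
      unfolding Y using U' V' B by simp
    also have "transpose_mat U * (U * ?B W * transpose_mat V) * V = ?B W"
    proof -
      have "transpose_mat U * (U * ?B W * transpose_mat V) = ?B W * transpose_mat V"
        using orthogonal_mult_cancel(1)[OF U, of "?B W * transpose_mat V" n "1\<^sub>m n"] U' V' B
        by (simp add: assoc_mult_mat[of U n n "?B W" n "transpose_mat V" n])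
      then show ?thesis
        using orthogonal_mult_cancel(4)[OF V, of "1\<^sub>m n" n "?B W"] B by simp
    qed
    finally have ZY: "?Z Y = - ?B W" .
    have "frob_inner N Y = (\<Sum>i<n. - S $$ (i, i))"
      using feas inner[of Y] unfolding ZY feasible_def
      using B(1) W(1) zero r by (auto intro!: sum.cong simp: not_less)
    then show ?thesis using feas nuc by (simp add: sum_negf)
  qed
  show ?min
  proof -
    from attained[OF zero_carrier_mat spectral_norm_zero_mat_le_1 refl] ge show ?thesis
      unfolding is_min_value_def by blast
  qed
  \<comment> \<open>As the minimum is attained, the minimisers are exactly the feasible points at
    the known value.\<close>
  then have arg_min: "is_arg_min (frob_inner N) feasible Y
      \<longleftrightarrow> feasible Y \<and> frob_inner N Y = - nuclear_norm N" for Y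
    unfolding is_arg_min_def is_min_value_def by (metis leD order_le_imp_less_or_eq)
  show "?L = ?R"
  proof (intro equalityI subsetI)
    fix Y assume "Y \<in> ?R"
    then show "Y \<in> ?L" using attained arg_min by blast
  next
    fix Y assume "Y \<in> ?L"
    then have Y: "feasible Y" "frob_inner N Y = - nuclear_norm N" using arg_min by auto
    then have Yc: "Y \<in> carrier_mat n n" by (simp add: feasible_def)
    \<comment> \<open>Each summand is the gap in \<open>term_ge\<close>, hence nonnegative; a
      vanishing sum makes all gaps vanish.\<close>
    have sum0: "(\<Sum>i<n. S $$ (i, i) * ?Z Y $$ (i, i) - - S $$ (i, i)) = 0"
      using Y(2) inner[OF Yc] nuc by (simp only: sum_subtractf sum_negf)
    have eq: "S $$ (i, i) * ?Z Y $$ (i, i) - - S $$ (i, i) = 0" if "i < n" for i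
    proof -
      have "0 \<le> S $$ (j, j) * ?Z Y $$ (j, j) - - S $$ (j, j)" if "j \<in> {..<n}" for j
        using term_ge[OF Y(1), of j] that by simp
      with sum0 show ?thesis
        using that by (subst (asm) sum_nonneg_eq_0_iff) blast+
    qed
    have "?Z Y $$ (i, i) = - 1" if "i < r" for i
    proof -
      have "S $$ (i, i) * (?Z Y $$ (i, i) + 1) = 0" using eq[of i] that r by (simp add: distrib_left)
      then show ?thesis using pos[OF that] by (metis add_eq_0_iff2 less_irrefl mult_eq_0_iff)
    qed
    from contraction_mat_diag_minus_one[OF Z[OF Y(1)] r this]
    obtain W where W: "W \<in> carrier_mat (n - r) (n - r)" "?Z Y = - ?B W" by blast
    have B: "?B W \<in> carrier_mat n n"
      using W r four_block_carrier_mat[of "1\<^sub>m r" r r W "n - r" "n - r"] by auto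
    have "contraction_mat (?B W)"
      using Z(2)[OF Y(1)] unfolding W(2) contraction_mat_uminus .
    then have "spectral_norm W \<le> 1"
      by (simp add: spectral_norm_le_1_iff_contraction contraction_mat_four_block[OF W(1)])
    moreover have "Y = - (U * ?B W * transpose_mat V)"
    proof -
      \<comment> \<open>Orthogonality inverts the change of coordinates, carrying the block form of
        \<open>?Z Y\<close> back to \<open>Y\<close>.\<close>
      have "Y = U * ?Z Y * transpose_mat V"
      proof -
        have "U * ?Z Y * transpose_mat V = U * (transpose_mat U * (Y * V)) * transpose_mat V"
          using U' V' Yc by (simp add: assoc_mult_mat[of _ n n Y n V n])
        also have "\<dots> = Y * V * transpose_mat V"
          using orthogonal_mult_cancel(2)[OF U, of "Y * V" n "1\<^sub>m n"] V' Yc by simp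
        also have "\<dots> = Y" by (rule orthogonal_mult_cancel(3)[OF V Yc Yc])
        finally show ?thesis ..
      qed
      also have "\<dots> = - (U * ?B W) * transpose_mat V"
        unfolding W(2) using U' B by (subst uminus_mult_right_mat) auto
      also have "\<dots> = - (U * ?B W * transpose_mat V)"
        using U' V' B by (intro uminus_mult_left_mat) auto
      finally show ?thesis .
    qed
    ultimately show "Y \<in> ?R" using W(1) by blast
  qed
qed

section \<open>Block form of the solutions\<close>

text \<open>As \<open>hcat\<close> is a 2 by 2 block matrix with lower blocks of height 0, the block
  product formula applies; the empty blocks around the result contribute no entries.\<close>

lemma block_mult_hcat:
  assumes "U\<^sub>1 \<in> carrier_mat n r" "U\<^sub>2 \<in> carrier_mat n k" "V\<^sub>1 \<in> carrier_mat m r" "V\<^sub>2 \<in> carrier_mat m l"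
    "W \<in> carrier_mat k l"
  shows "hcat U\<^sub>1 U\<^sub>2 * four_block_mat (1\<^sub>m r) (0\<^sub>m r l) (0\<^sub>m k r) W * transpose_mat (hcat V\<^sub>1 V\<^sub>2)
    = U\<^sub>1 * transpose_mat V\<^sub>1 + U\<^sub>2 * W * transpose_mat V\<^sub>2"
proof -
  let ?R = "U\<^sub>1 * transpose_mat V\<^sub>1 + U\<^sub>2 * W * transpose_mat V\<^sub>2"
  have "hcat U\<^sub>1 U\<^sub>2 * four_block_mat (1\<^sub>m r) (0\<^sub>m r l) (0\<^sub>m k r) W
      = four_block_mat U\<^sub>1 (U\<^sub>2 * W) (0\<^sub>m 0 r) (0\<^sub>m 0 l)"
    unfolding hcat_def using assms by (subst mult_four_block_mat[of _ n r _ k _ 0 _ _ r _ l]) auto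
  moreover have "transpose_mat (hcat V\<^sub>1 V\<^sub>2)
      = four_block_mat (transpose_mat V\<^sub>1) (0\<^sub>m r 0) (transpose_mat V\<^sub>2) (0\<^sub>m l 0)"
    unfolding hcat_def using assms by (subst transpose_four_block_mat[of _ m r _ l _ 0]) auto
  moreover have "four_block_mat U\<^sub>1 (U\<^sub>2 * W) (0\<^sub>m 0 r) (0\<^sub>m 0 l)
      * four_block_mat (transpose_mat V\<^sub>1) (0\<^sub>m r 0) (transpose_mat V\<^sub>2) (0\<^sub>m l 0)
      = four_block_mat ?R (0\<^sub>m n 0) (0\<^sub>m 0 m) (0\<^sub>m 0 0)"
    using assms by (subst mult_four_block_mat[of _ n r _ l _ 0 _ _ m _ 0]) auto
  moreover have "\<dots> = ?R"
    using assms by (intro eq_matI) auto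
  ultimately show ?thesis by simp
qed

section \<open>Positive semidefinite square roots and the matrix sign\<close>

lemma diagonal_quadratic_form:
  fixes S :: "real mat"
  assumes S: "S \<in> carrier_mat n n" "diagonal_mat S" and w: "w \<in> carrier_vec n"
  shows "w \<bullet> (S *\<^sub>v w) = (\<Sum>i = 0..<n. S $$ (i, i) * (w $ i)\<^sup>2)"
proof -
  have "(S *\<^sub>v w) $ i = S $$ (i, i) * w $ i" if "i < n" for i
  proof -
    have "(S *\<^sub>v w) $ i = (\<Sum>k = 0..<n. S $$ (i, k) * w $ k)"
      using that S w by (simp add: scalar_prod_def cong: sum.cong_simp)
    also have "\<dots> = (\<Sum>k = 0..<n. if k = i then S $$ (i, i) * w $ i else 0)"
      using that S by (intro sum.cong) (auto simp: diagonal_mat_def)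
    finally show ?thesis using that by simp
  qed
  then show ?thesis
    using S w
    by (auto simp: scalar_prod_def[of w] power2_eq_square intro!: sum.cong simp del: index_mult_mat_vec)
qed

text \<open>
  \<open>C\<close> commutes with \<open>C\<^sup>2 = S\<^sup>2\<close>, hence with \<open>S\<close> because the entries of \<open>S\<close> are positive. Therefore
  \<open>(C + S) (C - S) = 0\<close>, where \<open>C + S\<close> is positive definite.
\<close>
lemma positive_diagonal_psd_sqrt_unique:
  assumes S: "S \<in> carrier_mat n n" "diagonal_mat S" "\<And>i. i < n \<Longrightarrow> 0 < S $$ (i, i)"
    and C: "C \<in> carrier_mat n n" "psd_mat C" "C * C = S * S"
  shows "C = S"
proof -
  have comm: "C * S = S * C"
  proof (rule eq_matI)
    fix i j assume "i < dim_row (S * C)" "j < dim_col (S * C)"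
    then have ij: "i < n" "j < n" using S C by auto
    have SC: "S * C \<in> carrier_mat n n" "C * S \<in> carrier_mat n n" using S C by auto
    have "S * (S * C) = S * S * C"
      by (rule assoc_mult_mat[OF S(1) S(1) C(1), symmetric])
    also have "\<dots> = C * C * C" by (simp only: C(3))
    also have "\<dots> = C * (C * C)" by (rule assoc_mult_mat[OF C(1) C(1) C(1)])
    also have "\<dots> = C * (S * S)" by (simp only: C(3))
    also have "\<dots> = C * S * S" by (rule assoc_mult_mat[OF C(1) S(1) S(1), symmetric])
    finally have eq: "(S * (S * C)) $$ (i, j) = (C * S * S) $$ (i, j)" by simp
    note entries = diagonal_mult_entry(1)[OF S(2,1) C(1) C(1) ij]
      diagonal_mult_entry(2)[OF S(2,1) C(1) C(1) ij(2,1)]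
      diagonal_mult_entry(1)[OF S(2,1) SC(1) SC(1) ij]
      diagonal_mult_entry(2)[OF S(2,1) SC(2) SC(2) ij(2,1)]
    \<comment> \<open>This factors s_i^2 c_ij = c_ij s_j^2. The sum s_i + s_j is positive, so it
      cancels and leaves the commutation with \<open>S\<close>.\<close>
    have "(S $$ (i, i) + S $$ (j, j)) * ((S $$ (i, i) - S $$ (j, j)) * C $$ (i, j)) = 0"
      using eq unfolding entries by (simp add: algebra_simps)
    then have "(S $$ (i, i) - S $$ (j, j)) * C $$ (i, j) = 0"
      using S(3)[OF ij(1)] S(3)[OF ij(2)] by (metis add_pos_pos less_irrefl mult_eq_0_iff)
    then show "(C * S) $$ (i, j) = (S * C) $$ (i, j)"
      unfolding entries by auto
  qed (use S C in auto)
  have CS: "C + S \<in> carrier_mat n n" "C - S \<in> carrier_mat n n" using S C by auto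
  have prod0: "(C + S) * (C - S) = 0\<^sub>m n n"
  proof -
    have "(C + S) * (C - S) = (C * C + S * C) - (C * S + S * S)"
      using S C by (simp add: add_mult_distrib_mat[of _ n n] mult_minus_distrib_mat[of _ n n])
    also have "\<dots> = 0\<^sub>m n n"
      unfolding comm C(3) using S C by (intro eq_matI) (auto simp del: index_mult_mat(1))
    finally show ?thesis .
  qed
  \<comment> \<open>Both quadratic forms are nonnegative, so a zero sum makes the one of
    \<open>S\<close> vanish, and its positive weights then leave only w = 0.\<close>
  have ker: "w = 0\<^sub>v n" if w: "w \<in> carrier_vec n" "(C + S) *\<^sub>v w = 0\<^sub>v n" for w
  proof -
    have "w \<bullet> (C *\<^sub>v w) + w \<bullet> (S *\<^sub>v w) = 0"
      using w S C scalar_prod_add_distrib[OF w(1), of "C *\<^sub>v w" "S *\<^sub>v w"]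
      by (simp add: add_mult_distrib_mat_vec[of _ n n])
    moreover have "0 \<le> w \<bullet> (C *\<^sub>v w)" using C w by (auto simp: psd_mat_def)
    moreover have wSw: "w \<bullet> (S *\<^sub>v w) = (\<Sum>i = 0..<n. S $$ (i, i) * (w $ i)\<^sup>2)"
      by (rule diagonal_quadratic_form[OF S(1,2) w(1)])
    moreover have nonneg: "\<And>i. i < n \<Longrightarrow> 0 \<le> S $$ (i, i) * (w $ i)\<^sup>2"
      using S(3) by (simp add: less_imp_le)
    moreover have "0 \<le> w \<bullet> (S *\<^sub>v w)" unfolding wSw using nonneg by (intro sum_nonneg) auto
    ultimately have "(\<Sum>i = 0..<n. S $$ (i, i) * (w $ i)\<^sup>2) = 0" by linarith
    then have "S $$ (i, i) * (w $ i)\<^sup>2 = 0" if "i < n" for i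
      using nonneg that by (subst (asm) sum_nonneg_eq_0_iff) auto
    then have "w $ i = 0" if "i < n" for i using S(3)[OF that] that by force
    then show ?thesis using w by (intro eq_vecI) auto
  qed
  have "C - S = 0\<^sub>m n n"
  proof (rule eq_matI)
    fix i j assume "i < dim_row (0\<^sub>m n n :: real mat)" "j < dim_col (0\<^sub>m n n :: real mat)"
    then have ij: "i < n" "j < n" by auto
    \<comment> \<open>The trivial kernel of \<open>C + S\<close> is applied to one column of
      \<open>C - S\<close> at a time.\<close>
    have "(C + S) *\<^sub>v col (C - S) j = col ((C + S) * (C - S)) j"
      using CS ij by (intro eq_vecI) auto
    then have "(C + S) *\<^sub>v col (C - S) j = 0\<^sub>v n" unfolding prod0 using ij by simp
    then have "col (C - S) j = 0\<^sub>v n"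
      by (rule ker[rotated]) (use CS ij in auto)
    then have "col (C - S) j $ i = 0" using ij by simp
    then show "(C - S) $$ (i, j) = 0\<^sub>m n n $$ (i, j)" using CS ij by (simp del: index_minus_mat)
  qed (use CS in auto)
  then have "(C - S) $$ (i, j) = 0" if "i < n" "j < n" for i j using that by simp
  then show ?thesis using S C by (intro eq_matI) auto
qed

text \<open>The definite description requires existence and uniqueness. \<open>V S V\<^sup>T\<close>
  is a root by orthogonality; any other root becomes a root of \<open>S * S\<close> after
  conjugation by \<open>V\<close>, which reduces uniqueness to the diagonal case.\<close>

lemma psd_sqrt_gram_svd:
  assumes U: "U \<in> orthogonal_matrices n" and V: "V \<in> orthogonal_matrices n"
    and S: "S \<in> carrier_mat n n" "diagonal_mat S" "\<And>i. i < n \<Longrightarrow> 0 < S $$ (i, i)"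
    and N_def: "N = U * S * transpose_mat V"
  shows "psd_sqrt (transpose_mat N * N) = V * S * transpose_mat V"
proof -
  note V' = orthogonal_matricesD[OF V]
  let ?P = "V * S * transpose_mat V"
  have P: "?P \<in> carrier_mat n n" using V' S by simp
  have gram: "transpose_mat N * N = V * (S * S) * transpose_mat V"
    unfolding N_def by (rule gram_svd[OF U V S(1,2)])
  have dim: "dim_row (transpose_mat N * N) = n"
    unfolding gram using V' by simp
  have PP: "?P * ?P = transpose_mat N * N"
  proof -
    have "?P * ?P = V * (S * (transpose_mat V * (V * (S * transpose_mat V))))"
      using V' S by (simp add: assoc_mult_mat[of _ n n _ n _ n])
    also have "\<dots> = V * (S * (S * transpose_mat V))"
      using V' S by (subst orthogonal_mult_cancel(1)[OF V, of _ n "1\<^sub>m n"]) auto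
    finally show ?thesis
      unfolding gram using V' S by (simp add: assoc_mult_mat[of _ n n _ n _ n])
  qed
  have conj_form: "v \<bullet> ((transpose_mat Q * A * Q) *\<^sub>v v) = (Q *\<^sub>v v) \<bullet> (A *\<^sub>v (Q *\<^sub>v v))"
    if "Q \<in> carrier_mat n n" "A \<in> carrier_mat n n" "v \<in> carrier_vec n" for Q A :: "real mat" and v
  proof -
    have "(transpose_mat Q * A * Q) *\<^sub>v v = transpose_mat Q *\<^sub>v (A *\<^sub>v (Q *\<^sub>v v))"
      using that by (simp add: assoc_mult_mat_vec[of _ n n _ n] del: assoc_mult_mat)
    then show ?thesis
      using transpose_vec_mult_scalar[of "transpose_mat Q" n n "A *\<^sub>v (Q *\<^sub>v v)" v] that by simp
  qed
  \<comment> \<open>Used with Q = \<open>V\<^sup>T\<close> for the proposed root and with Q =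
    \<open>V\<close> for a competing one.\<close>
  have psd_conj: "psd_mat (transpose_mat Q * A * Q)"
    if "Q \<in> carrier_mat n n" "A \<in> carrier_mat n n" "psd_mat A" for Q A
  proof -
    have "transpose_mat (transpose_mat Q * A * Q) = transpose_mat Q * A * Q"
      using that unfolding psd_mat_def
      by (simp add: transpose_mult[of _ n n _ n] assoc_mult_mat[of _ n n _ n _ n])
    moreover have "0 \<le> v \<bullet> ((transpose_mat Q * A * Q) *\<^sub>v v)" if "v \<in> carrier_vec n" for v
      using conj_form[OF \<open>Q \<in> _\<close> \<open>A \<in> _\<close> that] \<open>Q \<in> _\<close> \<open>A \<in> _\<close> \<open>psd_mat A\<close> that
      by (simp add: psd_mat_def)
    ultimately show ?thesis using that by (simp add: psd_mat_def)
  qed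
  have "psd_mat S"
    unfolding psd_mat_def
  proof (intro conjI ballI)
    fix v :: "real vec" assume "v \<in> carrier_vec (dim_row S)"
    then have v: "v \<in> carrier_vec n" using S by simp
    have "v \<bullet> (S *\<^sub>v v) = (\<Sum>i = 0..<n. S $$ (i, i) * (v $ i)\<^sup>2)"
      by (rule diagonal_quadratic_form[OF S(1,2) v])
    then show "0 \<le> v \<bullet> (S *\<^sub>v v)" 
      using S(3) by (simp only:, intro sum_nonneg mult_nonneg_nonneg) (auto intro: less_imp_le)
  qed (use S diagonal_transpose in auto)
  then have psd_P: "psd_mat ?P"
    using psd_conj[of "transpose_mat V" S] V' S by simp
  show ?thesis
    unfolding psd_sqrt_def dim
  proof (rule the_equality)
    show "?P \<in> carrier_mat n n \<and> psd_mat ?P \<and> ?P * ?P = transpose_mat N * N"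
      using P psd_P PP by blast
    fix B assume "B \<in> carrier_mat n n \<and> psd_mat B \<and> B * B = transpose_mat N * N"
    then have B: "B \<in> carrier_mat n n" "psd_mat B" "B * B = V * (S * S) * transpose_mat V"
      by (auto simp: gram)
    define C where "C = transpose_mat V * B * V"
    have C: "C \<in> carrier_mat n n" using V' B by (simp add: C_def)
    have "C * C = transpose_mat V * (B * (V * (transpose_mat V * (B * V))))"
      unfolding C_def using V' B by (simp add: assoc_mult_mat[of _ n n _ n _ n])
    also have "\<dots> = transpose_mat V * (B * (B * V))"
      using V' B by (subst orthogonal_mult_cancel(2)[OF V, of _ n "1\<^sub>m n"]) auto
    also have "\<dots> = transpose_mat V * (B * B * V)"
      by (simp only: assoc_mult_mat[OF B(1) B(1) V'(1)])
    also have "\<dots> = transpose_mat V * (V * (S * S * (transpose_mat V * V)))"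
      unfolding B(3) using V' S by (simp add: assoc_mult_mat[of _ n n _ n _ n])
    also have "\<dots> = S * S"
      using V' S by (subst orthogonal_mult_cancel(1)[OF V, of _ n "1\<^sub>m n"]) auto
    finally have "C = S"
      using positive_diagonal_psd_sqrt_unique[OF S C] psd_conj[OF V'(1) B(1,2)] by (simp add: C_def)
    have "?P = V * (transpose_mat V * (B * (V * transpose_mat V)))"
      unfolding \<open>C = S\<close>[symmetric] C_def using V' B by (simp add: assoc_mult_mat[of _ n n _ n _ n])
    also have "\<dots> = B"
      using V' B by (subst orthogonal_mult_cancel(2)[OF V, of _ n "1\<^sub>m n"]) auto
    finally show "B = ?P" ..
  qed
qed

text \<open>This is the polar decomposition: \<open>N = (U V\<^sup>T) (V S V\<^sup>T)\<close>, where
  the second factor is the square root of the Gram matrix, and its inverse leaves the orthogonal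
  factor.\<close>

lemma msign_svd:
  assumes U: "U \<in> orthogonal_matrices n" and V: "V \<in> orthogonal_matrices n"
    and S: "S \<in> carrier_mat n n" "diagonal_mat S" "\<And>i. i < n \<Longrightarrow> 0 < S $$ (i, i)"
    and N_def: "N = U * S * transpose_mat V"
  shows "msign N = U * transpose_mat V"
proof -
  note U' = orthogonal_matricesD[OF U] and V' = orthogonal_matricesD[OF V]
  let ?P = "V * S * transpose_mat V"
  have P: "?P \<in> carrier_mat n n" using V' S by simp
  have "det S = prod_list (diag_mat S)"
    using S by (intro det_upper_triangular[of _ n]) (auto simp: upper_triangular_def diagonal_mat_def)
  also have "\<dots> \<noteq> 0"
  proof -
    have "S $$ (i, i) \<noteq> 0" if "i < n" for i using S(3)[OF that] by simp
    then show ?thesis using S(1) by (auto simp: prod_list_zero_iff diag_mat_def)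
  qed
  finally have "det S \<noteq> 0" .
  moreover have "det V * det (transpose_mat V) = 1"
    using V' det_mult[of V n "transpose_mat V"] by simp
  ultimately have "det ?P \<noteq> 0"
    using V' S by (auto simp: det_mult[of _ n])
  \<comment> \<open>Being a unit rules out the value \<open>None\<close> of
    \<open>mat_inverse\<close>.\<close>
  then have "?P \<in> Units (ring_mat TYPE(real) n ())"
    by (rule det_non_zero_imp_unit[OF P])
  then obtain R where R: "mat_inverse ?P = Some R"
    using mat_inverse(1)[OF P, of "()"] by (cases "mat_inverse ?P") auto
  have R': "?P * R = 1\<^sub>m n" "R \<in> carrier_mat n n" using mat_inverse(2)[OF P R] by auto
  have "msign N = N * R"
  proof -
    have "psd_sqrt (transpose_mat N * N) = ?P" by (rule psd_sqrt_gram_svd[OF U V S N_def])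
    then show ?thesis by (simp add: msign_def R)
  qed
  also have "N * R = U * transpose_mat V * ?P * R"
  proof -
    have "U * transpose_mat V * ?P = U * (transpose_mat V * (V * (S * transpose_mat V)))"
      using U' V' S by (simp add: assoc_mult_mat[of _ n n _ n _ n])
    also have "\<dots> = U * (S * transpose_mat V)"
      using V' S by (subst orthogonal_mult_cancel(1)[OF V, of _ n "1\<^sub>m n"]) auto
    finally have "U * transpose_mat V * ?P = N"
      unfolding N_def using U' V' S by (simp add: assoc_mult_mat[of _ n n _ n _ n])
    then show ?thesis by simp
  qed
  also have "\<dots> = U * transpose_mat V * (?P * R)"
    by (rule assoc_mult_mat[of _ n n _ n _ n]) (use U' V' P R' in auto)
  also have "\<dots> = U * transpose_mat V"
    unfolding R'(1) using U' V' by simp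
  finally show ?thesis .
qed

section \<open>The spectral norm problem for \<open>skew (M X\<^sup>T)\<close>\<close>

theorem proposition1:
  fixes n p r :: nat
    and M X N U V S S\<^sub>r U\<^sub>1 U\<^sub>2 V\<^sub>1 V\<^sub>2 :: "real mat"
    and feasible :: "real mat \<Rightarrow> bool" and obj :: "real mat \<Rightarrow> real"
  assumes "0 < p" and "p < n"
    and "M \<in> carrier_mat n p" and "X \<in> stiefel n p"
    and N_def: "N = skew (M * transpose_mat X)"
    and r_def: "r = vec_space.rank n N"
    and "is_svd N U S V"
    and "S\<^sub>r \<in> carrier_mat r r" and "diagonal_mat S\<^sub>r" and "\<forall>i<r. S\<^sub>r $$ (i,i) \<noteq> 0"
    and "S = four_block_mat S\<^sub>r (0\<^sub>m r (n-r)) (0\<^sub>m (n-r) r) (0\<^sub>m (n-r) (n-r))"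
    and "U\<^sub>1 \<in> carrier_mat n r" and "U\<^sub>2 \<in> carrier_mat n (n-r)" and "U = hcat U\<^sub>1 U\<^sub>2"
    and "V\<^sub>1 \<in> carrier_mat n r" and "V\<^sub>2 \<in> carrier_mat n (n-r)" and "V = hcat V\<^sub>1 V\<^sub>2"
    and feasible_def: "feasible = (\<lambda>Y. Y \<in> carrier_mat n n \<and> spectral_norm Y \<le> 1)"
    and obj_def: "obj = (\<lambda>Y. frob_inner (skew (M * transpose_mat X)) Y)"
  shows "is_min_value obj feasible (- nuclear_norm N)
    \<and> {Y. is_arg_min obj feasible Y} =
        {- (U * four_block_mat (1\<^sub>m r) (0\<^sub>m r (n-r)) (0\<^sub>m (n-r) r) W * transpose_mat V) | W.
           W \<in> carrier_mat (n-r) (n-r) \<and> spectral_norm W \<le> 1}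
    \<and> (\<forall>W \<in> carrier_mat (n-r) (n-r). spectral_norm W \<le> 1 \<longrightarrow>
         - (U * four_block_mat (1\<^sub>m r) (0\<^sub>m r (n-r)) (0\<^sub>m (n-r) r) W * transpose_mat V)
           = - (U\<^sub>1 * transpose_mat V\<^sub>1) - U\<^sub>2 * W * transpose_mat V\<^sub>2)
    \<and> (invertible_mat N \<longrightarrow>
         {Y. is_arg_min obj feasible Y} = {- msign N} \<and> - msign N = - (U * transpose_mat V))"
proof -
  note svd = assms(7)[unfolded is_svd_def] and S\<^sub>r = assms(8-10) and S_eq = assms(11)
  have X: "X \<in> carrier_mat n p" using assms(4) by (simp add: stiefel_def)
  have N: "N \<in> carrier_mat n n"
    unfolding N_def skew_def using assms(3) X by (intro smult_carrier_mat minus_carrier_mat) auto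
  have dims: "dim_row N = n" "dim_col N = n" using N by auto
  have U: "U \<in> orthogonal_matrices n" and V: "V \<in> orthogonal_matrices n"
    and S: "S \<in> carrier_mat n n" "diagonal_mat S"
    and S_nonneg: "\<And>i. i < n \<Longrightarrow> 0 \<le> S $$ (i, i)"
    and N_svd: "N = U * S * transpose_mat V"
    using svd dims by auto
  \<comment> \<open>Subtraction on naturals truncates, but \<open>S\<close> has r + (n - r) rows,
    and this equals n only if r \<le> n.\<close>
  have r: "r \<le> n"
  proof -
    have "dim_row S = r + (n - r)" unfolding S_eq using S\<^sub>r(1) by simp
    then show ?thesis using S(1) by simp
  qed
  have S_diag: "S $$ (i, i) = (if i < r then S\<^sub>r $$ (i, i) else 0)" if "i < n" for i
    unfolding S_eq using that r S\<^sub>r(1) by simp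
  have pos: "0 < S $$ (i, i)" if "i < r" for i
    using S_nonneg[of i] S_diag[of i] S\<^sub>r(3) that r by (simp add: less_le)
  have zero: "S $$ (i, i) = 0" if "r \<le> i" "i < n" for i
    using S_diag[of i] that by simp
  have obj: "obj = frob_inner N" by (simp add: obj_def N_def)
  let ?opt = "{- (U * four_block_mat (1\<^sub>m r) (0\<^sub>m r (n-r)) (0\<^sub>m (n-r) r) W * transpose_mat V) | W.
    W \<in> carrier_mat (n-r) (n-r) \<and> spectral_norm W \<le> 1}"
  have minimum: "is_min_value obj feasible (- nuclear_norm N)"
    unfolding obj feasible_def by (rule svd_linear_minimisers(1)[OF U V S r pos zero N_svd])
  have minimisers: "{Y. is_arg_min obj feasible Y} = ?opt"
    unfolding obj feasible_def by (rule svd_linear_minimisers(2)[OF U V S r pos zero N_svd])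
  have blocks: "- (U * four_block_mat (1\<^sub>m r) (0\<^sub>m r (n-r)) (0\<^sub>m (n-r) r) W * transpose_mat V)
      = - (U\<^sub>1 * transpose_mat V\<^sub>1) - U\<^sub>2 * W * transpose_mat V\<^sub>2"
    if W: "W \<in> carrier_mat (n-r) (n-r)" for W
  proof -
    have "- (U * four_block_mat (1\<^sub>m r) (0\<^sub>m r (n-r)) (0\<^sub>m (n-r) r) W * transpose_mat V)
        = - (U\<^sub>1 * transpose_mat V\<^sub>1 + U\<^sub>2 * W * transpose_mat V\<^sub>2)"
      unfolding assms(14,17) by (subst block_mult_hcat[OF assms(12,13,15,16) W]) simp
    also have "\<dots> = - (U\<^sub>1 * transpose_mat V\<^sub>1) - U\<^sub>2 * W * transpose_mat V\<^sub>2"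
      using assms(12,13,15,16) W by (intro eq_matI) (auto simp del: index_mult_mat(1))
    finally show ?thesis .
  qed
  have nonsingular: "{Y. is_arg_min obj feasible Y} = {- msign N}"
    "- msign N = - (U * transpose_mat V)" if inv: "invertible_mat N"
  proof -
    obtain B where NB: "N * B = 1\<^sub>m n" and BN: "B * N = 1\<^sub>m (dim_row B)"
      using inv dims unfolding invertible_mat_def inverts_mat_def by auto
    \<comment> \<open>Invertibility prescribes no shape for \<open>B\<close>; the column counts of
      the two identities determine it.\<close>
    have B: "B \<in> carrier_mat n n"
      using arg_cong[OF NB, of dim_col] arg_cong[OF BN, of dim_col] dims by auto
    have "det N \<noteq> 0" using det_mult[OF N B] NB by auto
    then have "det S \<noteq> 0"
      unfolding N_svd using S orthogonal_matricesD[OF U] orthogonal_matricesD[OF V]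
      by (auto simp: det_mult[of _ n])
    moreover have "det S = prod_list (diag_mat S)"
      using S by (intro det_upper_triangular[of _ n]) (auto simp: upper_triangular_def diagonal_mat_def)
    ultimately have "S $$ (i, i) \<noteq> 0" if "i < n" for i
      using S(1) that by (auto simp: prod_list_zero_iff diag_mat_def)
    \<comment> \<open>If r < n, then position r of the diagonal would hold a zero.\<close>
    then have rn: "r = n" using zero[of r] r by (cases "r < n") auto
    have sign: "msign N = U * transpose_mat V"
      using pos by (intro msign_svd[OF U V S _ N_svd]) (simp add: rn)
    then show "- msign N = - (U * transpose_mat V)" by simp
    \<comment> \<open>For r = n the free block is 0 by 0, so all choices of \<open>W\<close> yield
      the same matrix.\<close>
    have block: "four_block_mat (1\<^sub>m r) (0\<^sub>m r (n-r)) (0\<^sub>m (n-r) r) W = 1\<^sub>m n"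
      if "W \<in> carrier_mat (n-r) (n-r)" for W :: "real mat"
      using that rn by (intro eq_matI) auto
    have "- (U * 1\<^sub>m n * transpose_mat V) \<in> ?opt"
      using block[OF zero_carrier_mat] spectral_norm_zero_mat_le_1[of "n - r" "n - r"]
      by (auto intro!: exI[of _ "0\<^sub>m (n - r) (n - r)"])
    moreover have "Y = - (U * 1\<^sub>m n * transpose_mat V)" if "Y \<in> ?opt" for Y
      using that block by auto
    ultimately have "{Y. is_arg_min obj feasible Y} = {- (U * 1\<^sub>m n * transpose_mat V)}"
      unfolding minimisers by blast
    then show "{Y. is_arg_min obj feasible Y} = {- msign N}"
      unfolding sign using orthogonal_matricesD(1)[OF U] by simp
  qed
  show ?thesis
    using minimum minimisers blocks nonsingular by blast
qed

end
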